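(* For $i\in\mathbb{N}$ let $A^{\uparrow\uparrow}_i=x\otimes(t-1)^i$, $B^{\uparrow\uparrow}_i=(y\otimes t+z\otimes(t-1))(t-1)^i$, $\psi^{\uparrow\uparrow}_{i+1}=z\otimes(t-1)^{i+1}$; these elements form a basis, denoted $[0312]$, of the Onsager Lie algebra $O$. The basis $[0312]$ is recursively obtained in the order $$A^{\uparrow\uparrow}_0,\ B^{\uparrow\uparrow}_0,\ \psi^{\uparrow\uparrow}_1,\ A^{\uparrow\uparrow}_1,\ B^{\uparrow\uparrow}_1,\ \psi^{\uparrow\uparrow}_2,\ A^{\uparrow\uparrow}_2,\ B^{\uparrow\uparrow}_2,\ \psi^{\uparrow\uparrow}_3,\ \ldots$$ using $A^{\uparrow\uparrow}_0=A$, $B^{\uparrow\uparrow}_0=B$ and the following equations for $i\geq1$: $$\begin{aligned} \psi^{\uparrow\uparrow}_i&=\frac{A^{\uparrow\uparrow}_{i-1}}{2}+\frac{B^{\uparrow\uparrow}_{i-1}}{2}-\frac{[A^{\uparrow\uparrow}_{i-1},B]}{4},\\ A^{\uparrow\uparrow}_i&=\frac{[\psi^{\uparrow\uparrow}_i,A]}{2}-\psi^{\uparrow\uparrow}_i,\\ B^{\uparrow\uparrow}_i&=\frac{[B,\psi^{\uparrow\uparrow}_i]}{2}-\psi^{\uparrow\uparrow}_i. \end{aligned}$$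
   Context: $\mathbb{F}$ is a field of characteristic zero; $\mathbb{N}=\{0,1,2,\ldots\}$; tensor products are over $\mathbb{F}$. $\mathfrak{sl}_2$ is the Lie algebra over $\mathbb{F}$ with basis $e,f,h$ and $[h,e]=2e$, $[h,f]=-2f$, $[e,f]=h$. Its equitable basis is $x=2e-h$, $y=-2f-h$, $z=h$, which satisfies $[x,y]=2x+2y$, $[y,z]=2y+2z$, $[z,x]=2z+2x$. Let $t$ be an indeterminate and $\mathcal{A}=\mathbb{F}[t,t^{-1},(t-1)^{-1}]$. The three-point $\mathfrak{sl}_2$ loop algebra $L(\mathfrak{sl}_2)^+$ is the vector space $\mathfrak{sl}_2\otimes\mathcal{A}$ with Lie bracket $[u\otimes a,v\otimes b]=[u,v]\otimes ab$. It is a right $\mathcal{A}$-module via $(u\otimes a)b=u\otimes ab$. The Onsager Lie algebra $O$ (generators $A,B$; relations $[A,[A,[A,B]]]=4[A,B]$, $[B,[B,[B,A]]]=4[B,A]$) is identified with the Lie subalgebra of $L(\mathfrak{sl}_2)^+$ generated by $A=x\otimes1$ and $B=y\otimes t+z\otimes(t-1)$. *)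

theory Defs
  imports
    "HOL-Library.Poly_Mapping"
    "HOL-Computational_Algebra.Computational_Algebra"
begin

section \<open>The Lie algebra \<open>sl\<^sub>2\<close>\<close>

text \<open>\<open>Sl2 a b c\<close> stands for \<open>a e + b f + c h\<close>.\<close>

datatype 'a sl2 = Sl2 (coord_e: 'a) (coord_f: 'a) (coord_h: 'a)

instantiation sl2 :: (ab_group_add) ab_group_add
begin
definition zero_sl2 :: "'a sl2" where "0 = Sl2 0 0 0"
definition plus_sl2 :: "'a sl2 \<Rightarrow> 'a sl2 \<Rightarrow> 'a sl2" where
  "u + v = Sl2 (coord_e u + coord_e v) (coord_f u + coord_f v) (coord_h u + coord_h v)"
definition uminus_sl2 :: "'a sl2 \<Rightarrow> 'a sl2" where
  "- u = Sl2 (- coord_e u) (- coord_f u) (- coord_h u)"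
definition minus_sl2 :: "'a sl2 \<Rightarrow> 'a sl2 \<Rightarrow> 'a sl2" where
  "u - v = Sl2 (coord_e u - coord_e v) (coord_f u - coord_f v) (coord_h u - coord_h v)"
instance
  by standard (auto simp: zero_sl2_def plus_sl2_def uminus_sl2_def minus_sl2_def)
end

definition scale_sl2 :: "'a::field \<Rightarrow> 'a sl2 \<Rightarrow> 'a sl2" where
  "scale_sl2 r u = Sl2 (r * coord_e u) (r * coord_f u) (r * coord_h u)"

text \<open>The bilinear, alternating extension of \<open>[h,e] = 2e\<close>, \<open>[h,f] = -2f\<close>, \<open>[e,f] = h\<close>.\<close>

definition sl2_bracket :: "'a::field sl2 \<Rightarrow> 'a sl2 \<Rightarrow> 'a sl2" where
  "sl2_bracket u v = Sl2
     (2 * (coord_h u * coord_e v - coord_e u * coord_h v))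
     (- 2 * (coord_h u * coord_f v - coord_f u * coord_h v))
     (coord_e u * coord_f v - coord_f u * coord_e v)"

definition sl2_e :: "'a::field sl2" where "sl2_e = Sl2 1 0 0"
definition sl2_f :: "'a::field sl2" where "sl2_f = Sl2 0 1 0"
definition sl2_h :: "'a::field sl2" where "sl2_h = Sl2 0 0 1"

definition sl2_x :: "'a::field sl2" where "sl2_x = scale_sl2 2 sl2_e - sl2_h"
definition sl2_y :: "'a::field sl2" where "sl2_y = scale_sl2 (- 2) sl2_f - sl2_h"
definition sl2_z :: "'a::field sl2" where "sl2_z = sl2_h"

lemmas sl2_defs = zero_sl2_def plus_sl2_def uminus_sl2_def minus_sl2_def
  scale_sl2_def sl2_bracket_def sl2_e_def sl2_f_def sl2_h_def
  sl2_x_def sl2_y_def sl2_z_def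

lemma sl2_bracket_basis:
  "sl2_bracket sl2_h sl2_e = scale_sl2 2 sl2_e"
  "sl2_bracket sl2_h sl2_f = scale_sl2 (- 2) sl2_f"
  "sl2_bracket sl2_e sl2_f = sl2_h"
  by (simp_all add: sl2_defs)

lemma sl2_bracket_equitable:
  "sl2_bracket sl2_x sl2_y = scale_sl2 2 sl2_x + scale_sl2 2 sl2_y"
  "sl2_bracket sl2_y sl2_z = scale_sl2 2 sl2_y + scale_sl2 2 sl2_z"
  "sl2_bracket sl2_z sl2_x = scale_sl2 2 sl2_z + scale_sl2 2 sl2_x"
  by (simp_all add: sl2_defs)

section \<open>The algebra \<open>F[t, t\<^sup>-\<^sup>1, (t - 1)\<^sup>-\<^sup>1]\<close>\<close>

text \<open>A localization of \<open>F[t]\<close>, realized inside the field of rational functions: the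
  elements are the fractions whose denominator is \<open>t\<^sup>m (t - 1)\<^sup>n\<close>.\<close>

typedef (overloaded) 'a three_point =
  "{r :: 'a::field poly fract. \<exists>p m n. r = Fract p ([:0, 1:] ^ m * [:- 1, 1:] ^ n)}"
  morphisms rat_of_three_point three_point_of_rat
  by blast

setup_lifting type_definition_three_point

lemma three_point_denominator_nonzero [simp]:
  "[:0, 1:] ^ m * [:- 1, 1:] ^ n \<noteq> (0 :: 'a::field poly)"
  by simp

lemma three_point_const:
  "\<exists>p m n. Fract [:c:] 1 = Fract p ([:0, 1:] ^ m * [:- 1, 1:] ^ n :: 'a::field poly)"
  by (rule exI[of _ "[:c:]"], rule exI[of _ 0], rule exI[of _ 0]) simp

lemma three_point_add:
  fixes r s :: "'a::field poly fract"
  assumes "\<exists>p m n. r = Fract p ([:0, 1:] ^ m * [:- 1, 1:] ^ n)"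
    and "\<exists>p m n. s = Fract p ([:0, 1:] ^ m * [:- 1, 1:] ^ n)"
  shows "\<exists>p m n. r + s = Fract p ([:0, 1:] ^ m * [:- 1, 1:] ^ n)"
proof -
  obtain p m n where r: "r = Fract p ([:0, 1:] ^ m * [:- 1, 1:] ^ n)" using assms(1) by blast
  obtain q k l where s: "s = Fract q ([:0, 1:] ^ k * [:- 1, 1:] ^ l)" using assms(2) by blast
  have d: "([:0, 1:] ^ m * [:- 1, 1:] ^ n) * ([:0, 1:] ^ k * [:- 1, 1:] ^ l)
      = [:0, 1:] ^ (m + k) * ([:- 1, 1:] ^ (n + l) :: 'a poly)"
    by (simp only: power_add ac_simps)
  show ?thesis
    unfolding r s add_fract[OF three_point_denominator_nonzero three_point_denominator_nonzero] d
    by blast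
qed

lemma three_point_mult:
  fixes r s :: "'a::field poly fract"
  assumes "\<exists>p m n. r = Fract p ([:0, 1:] ^ m * [:- 1, 1:] ^ n)"
    and "\<exists>p m n. s = Fract p ([:0, 1:] ^ m * [:- 1, 1:] ^ n)"
  shows "\<exists>p m n. r * s = Fract p ([:0, 1:] ^ m * [:- 1, 1:] ^ n)"
proof -
  obtain p m n where r: "r = Fract p ([:0, 1:] ^ m * [:- 1, 1:] ^ n)" using assms(1) by blast
  obtain q k l where s: "s = Fract q ([:0, 1:] ^ k * [:- 1, 1:] ^ l)" using assms(2) by blast
  have d: "([:0, 1:] ^ m * [:- 1, 1:] ^ n) * ([:0, 1:] ^ k * [:- 1, 1:] ^ l)
      = [:0, 1:] ^ (m + k) * ([:- 1, 1:] ^ (n + l) :: 'a poly)"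
    by (simp only: power_add ac_simps)
  show ?thesis unfolding r s mult_fract d by blast
qed

lemma three_point_uminus:
  fixes r :: "'a::field poly fract"
  assumes "\<exists>p m n. r = Fract p ([:0, 1:] ^ m * [:- 1, 1:] ^ n)"
  shows "\<exists>p m n. - r = Fract p ([:0, 1:] ^ m * [:- 1, 1:] ^ n)"
  using assms by (metis minus_fract)

instantiation three_point :: (field) comm_ring_1
begin
lift_definition zero_three_point :: "'a three_point" is 0
  using three_point_const[of 0] by (simp add: Zero_fract_def)
lift_definition one_three_point :: "'a three_point" is 1
  using three_point_const[of 1] by (simp add: One_fract_def one_pCons)
lift_definition plus_three_point :: "'a three_point \<Rightarrow> 'a three_point \<Rightarrow> 'a three_point"
  is "(+)" by (rule three_point_add)
lift_definition times_three_point :: "'a three_point \<Rightarrow> 'a three_point \<Rightarrow> 'a three_point"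
  is "(*)" by (rule three_point_mult)
lift_definition uminus_three_point :: "'a three_point \<Rightarrow> 'a three_point"
  is uminus by (rule three_point_uminus)
lift_definition minus_three_point :: "'a three_point \<Rightarrow> 'a three_point \<Rightarrow> 'a three_point"
  is "(-)"
  by (metis diff_conv_add_uminus three_point_add three_point_uminus)
instance
  by standard (transfer; simp add: algebra_simps)+
end

lift_definition const_three_point :: "'a::field \<Rightarrow> 'a three_point" is "\<lambda>c. Fract [:c:] 1"
  by (rule three_point_const)

lift_definition tvar :: "'a::field three_point" is "Fract [:0, 1:] 1"
  by (rule exI[of _ "[:0, 1:]"], rule exI[of _ 0], rule exI[of _ 0]) simp

definition scale_three_point :: "'a::field \<Rightarrow> 'a three_point \<Rightarrow> 'a three_point" where
  "scale_three_point c a = const_three_point c * a"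

lemma tvar_invertible: "\<exists>a. tvar * a = (1 :: 'a::field three_point)"
proof (transfer, intro bexI conjI)
  show "Fract [:0, 1:] 1 * Fract 1 [:0, 1:] = (1 :: 'a poly fract)"
    by (simp add: One_fract_def eq_fract)
  show "Fract 1 [:0, 1:] \<in> {r :: 'a poly fract. \<exists>p m n. r = Fract p ([:0, 1:] ^ m * [:- 1, 1:] ^ n)}"
    by (rule CollectI, rule exI[of _ 1], rule exI[of _ 1], rule exI[of _ 0]) simp
qed

lemma tvar_minus_1_invertible: "\<exists>a. (tvar - 1) * a = (1 :: 'a::field three_point)"
proof (transfer, intro bexI conjI)
  show "(Fract [:0, 1:] 1 - 1) * Fract 1 [:- 1, 1:] = (1 :: 'a poly fract)"
    by (simp add: One_fract_def eq_fract one_pCons)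
  show "Fract 1 [:- 1, 1:] \<in> {r :: 'a poly fract. \<exists>p m n. r = Fract p ([:0, 1:] ^ m * [:- 1, 1:] ^ n)}"
    by (rule CollectI, rule exI[of _ 1], rule exI[of _ 0], rule exI[of _ 1]) simp
qed

lemma const_three_point_hom:
  "const_three_point (a + b) = const_three_point a + const_three_point b"
  "const_three_point (a * b) = const_three_point a * const_three_point b"
  "const_three_point 1 = 1"
  by (transfer; simp add: One_fract_def one_pCons)+

section \<open>The tensor product \<open>sl\<^sub>2 \<otimes> F[t, t\<^sup>-\<^sup>1, (t - 1)\<^sup>-\<^sup>1]\<close>\<close>

text \<open>The vector space freely generated by the pairs \<open>(u, a)\<close>, modulo the subspace spanned by the
  bilinearity relators.\<close>

type_synonym 'a free_pairs = "('a sl2 \<times> 'a three_point) \<Rightarrow>\<^sub>0 'a"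

definition scale_free :: "'a::field \<Rightarrow> 'a free_pairs \<Rightarrow> 'a free_pairs" where
  "scale_free c p = Poly_Mapping.map ((*) c) p"

lemma lookup_scale_free [simp]:
  "Poly_Mapping.lookup (scale_free c p) k = c * Poly_Mapping.lookup p k"
  by (simp add: scale_free_def Poly_Mapping.map.rep_eq when_def)

global_interpretation free: vector_space "scale_free :: 'a::field \<Rightarrow> _"
  by standard (rule poly_mapping_eqI, simp add: lookup_add algebra_simps)+

abbreviation free_gen :: "'a::field sl2 \<Rightarrow> 'a three_point \<Rightarrow> 'a free_pairs" where
  "free_gen u a \<equiv> Poly_Mapping.single (u, a) 1"

inductive_set tensor_relators :: "'a::field free_pairs set" where
  "free_gen (u + v) a - free_gen u a - free_gen v a \<in> tensor_relators"
| "free_gen u (a + b) - free_gen u a - free_gen u b \<in> tensor_relators"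
| "free_gen (scale_sl2 c u) a - scale_free c (free_gen u a) \<in> tensor_relators"
| "free_gen u (scale_three_point c a) - scale_free c (free_gen u a) \<in> tensor_relators"

definition tensor_eq :: "'a::field free_pairs \<Rightarrow> 'a free_pairs \<Rightarrow> bool" where
  "tensor_eq p q \<longleftrightarrow> p - q \<in> free.span tensor_relators"

lemma tensor_eq_equivp: "equivp (tensor_eq :: 'a::field free_pairs \<Rightarrow> 'a free_pairs \<Rightarrow> bool)"
proof (rule equivpI)
  show "reflp tensor_eq"
    by (simp add: reflp_def tensor_eq_def free.span_zero)
  show "symp tensor_eq"
    unfolding symp_def tensor_eq_def
    using free.span_neg[of "_ - _" tensor_relators] by (simp only: minus_diff_eq) blast
  show "transp (tensor_eq :: 'a free_pairs \<Rightarrow> 'a free_pairs \<Rightarrow> bool)"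
  proof (rule transpI)
    fix p q r :: "'a free_pairs"
    assume "tensor_eq p q" "tensor_eq q r"
    then have "(p - q) + (q - r) \<in> free.span tensor_relators"
      unfolding tensor_eq_def by (rule free.span_add)
    then show "tensor_eq p r" by (simp add: tensor_eq_def)
  qed
qed

quotient_type (overloaded) 'a loop_sl2 = "'a::field free_pairs" / tensor_eq
  by (rule tensor_eq_equivp)

lemma abs_rep_loop: "abs_loop_sl2 (rep_loop_sl2 X) = X"
  by (rule Quotient3_abs_rep[OF Quotient3_loop_sl2])

lemma tensor_eq_rep_abs: "tensor_eq (rep_loop_sl2 (abs_loop_sl2 p)) p"
  by (rule rep_abs_rsp_left[OF Quotient3_loop_sl2]) (simp add: tensor_eq_def free.span_zero)

instantiation loop_sl2 :: (field) ab_group_add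
begin
lift_definition zero_loop_sl2 :: "'a loop_sl2" is 0 .
lift_definition plus_loop_sl2 :: "'a loop_sl2 \<Rightarrow> 'a loop_sl2 \<Rightarrow> 'a loop_sl2" is "(+)"
  unfolding tensor_eq_def add_diff_add by (rule free.span_add)
lift_definition uminus_loop_sl2 :: "'a loop_sl2 \<Rightarrow> 'a loop_sl2" is uminus
  unfolding tensor_eq_def minus_diff_minus by (rule free.span_neg)
lift_definition minus_loop_sl2 :: "'a loop_sl2 \<Rightarrow> 'a loop_sl2 \<Rightarrow> 'a loop_sl2" is "(-)"
proof -
  fix p p' q q' :: "'a free_pairs"
  assume "tensor_eq p p'" "tensor_eq q q'"
  then have "(p - p') - (q - q') \<in> free.span tensor_relators"
    unfolding tensor_eq_def by (rule free.span_diff)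
  also have "(p - p') - (q - q') = (p - q) - (p' - q')" by simp
  finally show "tensor_eq (p - q) (p' - q')" by (simp add: tensor_eq_def)
qed
instance
  by standard (transfer; simp add: tensor_eq_def free.span_zero algebra_simps)+
end

lift_definition scale_loop :: "'a::field \<Rightarrow> 'a loop_sl2 \<Rightarrow> 'a loop_sl2" is scale_free
  unfolding tensor_eq_def free.scale_right_diff_distrib[symmetric] by (rule free.span_scale)

global_interpretation loop: vector_space "scale_loop :: 'a::field \<Rightarrow> _"
  by standard (transfer; simp add: tensor_eq_def free.span_zero free.scale_right_distrib
    free.scale_left_distrib)+

lift_definition tensor :: "'a::field sl2 \<Rightarrow> 'a three_point \<Rightarrow> 'a loop_sl2"  (infix "\<otimes>" 75)
  is free_gen .

lemma tensor_bilinear: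
  "(u + v) \<otimes> a = u \<otimes> a + v \<otimes> a"
  "u \<otimes> (a + b) = u \<otimes> a + u \<otimes> b"
  "scale_sl2 c u \<otimes> a = scale_loop c (u \<otimes> a)"
  "u \<otimes> scale_three_point c a = scale_loop c (u \<otimes> a)"
  by (transfer, unfold tensor_eq_def,
      metis free.span_base tensor_relators.intros diff_diff_eq)+

text \<open>The linear map out of the tensor product induced by a map \<open>\<phi>\<close> on pairs; \<open>s\<close> is the scalar
  multiplication of the codomain. It is meant for bilinear \<open>\<phi>\<close>, where the
  value does not depend on the choice of a representative (see \<open>tensor_lift_linear\<close> and
  \<open>tensor_lift_tensor\<close>, the universal property).\<close>

definition free_lift ::
  "('a::field \<Rightarrow> 'b \<Rightarrow> 'b) \<Rightarrow> ('a sl2 \<Rightarrow> 'a three_point \<Rightarrow> 'b) \<Rightarrow> 'a free_pairs \<Rightarrow> 'b::ab_group_add"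
  where "free_lift s \<phi> p =
    (\<Sum>(u, a)\<in>Poly_Mapping.keys p. s (Poly_Mapping.lookup p (u, a)) (\<phi> u a))"

definition tensor_lift ::
  "('a::field \<Rightarrow> 'b \<Rightarrow> 'b) \<Rightarrow> ('a sl2 \<Rightarrow> 'a three_point \<Rightarrow> 'b) \<Rightarrow> 'a loop_sl2 \<Rightarrow> 'b::ab_group_add"
  where "tensor_lift s \<phi> X = free_lift s \<phi> (rep_loop_sl2 X)"

definition bilinear_pairs ::
  "('a::field \<Rightarrow> 'b \<Rightarrow> 'b) \<Rightarrow> ('a sl2 \<Rightarrow> 'a three_point \<Rightarrow> 'b::ab_group_add) \<Rightarrow> bool"
  where "bilinear_pairs s \<phi> \<longleftrightarrow>
    (\<forall>u v a. \<phi> (u + v) a = \<phi> u a + \<phi> v a) \<and>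
    (\<forall>u a b. \<phi> u (a + b) = \<phi> u a + \<phi> u b) \<and>
    (\<forall>c u a. \<phi> (scale_sl2 c u) a = s c (\<phi> u a)) \<and>
    (\<forall>c u a. \<phi> u (scale_three_point c a) = s c (\<phi> u a))"

context
  fixes s :: "'a::field \<Rightarrow> 'b::ab_group_add \<Rightarrow> 'b"
  assumes vs: "vector_space s"
begin

interpretation S: vector_space s by (rule vs)

lemma free_lift_superset:
  assumes "finite K" "Poly_Mapping.keys p \<subseteq> K"
  shows "free_lift s \<phi> p = (\<Sum>(u, a)\<in>K. s (Poly_Mapping.lookup p (u, a)) (\<phi> u a))"
  unfolding free_lift_def
  by (rule sum.mono_neutral_left) (use assms in \<open>auto simp: in_keys_iff\<close>)

lemma free_lift_add: "free_lift s \<phi> (p + q) = free_lift s \<phi> p + free_lift s \<phi> q"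
proof -
  let ?K = "Poly_Mapping.keys p \<union> Poly_Mapping.keys q"
  have "free_lift s \<phi> r = (\<Sum>(u, a)\<in>?K. s (Poly_Mapping.lookup r (u, a)) (\<phi> u a))"
    if "Poly_Mapping.keys r \<subseteq> ?K" for r
    by (rule free_lift_superset) (use that in auto)
  then show ?thesis
    using Poly_Mapping.keys_add[of p q]
    by (simp add: lookup_add S.scale_left_distrib sum.distrib case_prod_beta)
qed

lemma free_lift_scale: "free_lift s \<phi> (scale_free c p) = s c (free_lift s \<phi> p)"
proof -
  have "Poly_Mapping.keys (scale_free c p) \<subseteq> Poly_Mapping.keys p"
    by (auto simp: in_keys_iff)
  then have "free_lift s \<phi> (scale_free c p) = (\<Sum>(u, a)\<in>Poly_Mapping.keys p.
      s (Poly_Mapping.lookup (scale_free c p) (u, a)) (\<phi> u a))"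
    by (intro free_lift_superset) auto
  also have "\<dots> = s c (free_lift s \<phi> p)"
    by (simp add: free_lift_def S.scale_sum_right case_prod_beta)
  finally show ?thesis .
qed

lemma free_lift_linear: "Vector_Spaces.linear scale_free s (free_lift s \<phi>)"
  by (intro Vector_Spaces.linear_iff[THEN iffD2] conjI allI free_lift_add free_lift_scale vs
      free.vector_space_axioms)

lemma free_lift_gen: "free_lift s \<phi> (free_gen u a) = \<phi> u a"
  by (simp add: free_lift_def)

lemma free_lift_cong:
  assumes "bilinear_pairs s \<phi>" "tensor_eq p q"
  shows "free_lift s \<phi> p = free_lift s \<phi> q"
proof -
  interpret L: Vector_Spaces.linear scale_free s "free_lift s \<phi>" by (rule free_lift_linear)
  have "free_lift s \<phi> r = 0" if "r \<in> tensor_relators" for r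
    using that assms(1)
    by cases (auto simp: L.diff L.scale free_lift_gen bilinear_pairs_def)
  then have "free_lift s \<phi> r = 0" if "r \<in> free.span tensor_relators" for r
    using that L.eq_0_on_span by blast
  then have "free_lift s \<phi> (p - q) = 0"
    using assms(2) by (simp add: tensor_eq_def)
  then show ?thesis by (simp add: L.diff)
qed

lemma tensor_lift_abs:
  assumes "bilinear_pairs s \<phi>"
  shows "tensor_lift s \<phi> (abs_loop_sl2 p) = free_lift s \<phi> p"
  unfolding tensor_lift_def
  by (rule free_lift_cong[OF assms]) (rule tensor_eq_rep_abs)

lemma tensor_lift_linear:
  assumes "bilinear_pairs s \<phi>"
  shows "Vector_Spaces.linear scale_loop s (tensor_lift s \<phi>)"
proof (intro Vector_Spaces.linear_iff[THEN iffD2] conjI allI vs loop.vector_space_axioms)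
  fix X Y :: "'a loop_sl2" and c
  obtain p q where X: "X = abs_loop_sl2 p" and Y: "Y = abs_loop_sl2 q"
    by (metis abs_rep_loop)
  show "tensor_lift s \<phi> (X + Y) = tensor_lift s \<phi> X + tensor_lift s \<phi> Y"
    by (simp add: X Y plus_loop_sl2.abs_eq tensor_lift_abs[OF assms] free_lift_add)
  show "tensor_lift s \<phi> (scale_loop c X) = s c (tensor_lift s \<phi> X)"
    by (simp add: X scale_loop.abs_eq tensor_lift_abs[OF assms] free_lift_scale)
qed

lemma tensor_lift_tensor:
  assumes "bilinear_pairs s \<phi>"
  shows "tensor_lift s \<phi> (u \<otimes> a) = \<phi> u a"
  by (simp add: tensor.abs_eq tensor_lift_abs[OF assms] free_lift_gen)

end

section \<open>The three-point \<open>sl\<^sub>2\<close> loop algebra\<close>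

definition loop_action :: "'a::field loop_sl2 \<Rightarrow> 'a three_point \<Rightarrow> 'a loop_sl2"
  where "loop_action X b = tensor_lift scale_loop (\<lambda>u a. u \<otimes> (a * b)) X"

definition loop_bracket :: "'a::field loop_sl2 \<Rightarrow> 'a loop_sl2 \<Rightarrow> 'a loop_sl2"
  where "loop_bracket X Y =
    tensor_lift scale_loop
      (\<lambda>u a. tensor_lift scale_loop (\<lambda>v b. sl2_bracket u v \<otimes> (a * b)) Y) X"

lemma loop_action_bilinear_pairs:
  "bilinear_pairs scale_loop (\<lambda>u a. u \<otimes> (a * b))"
  by (auto simp: bilinear_pairs_def tensor_bilinear distrib_right scale_three_point_def mult.assoc
      simp flip: tensor_bilinear(4))

lemma loop_action_tensor: "loop_action (u \<otimes> a) b = u \<otimes> (a * b)"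
  unfolding loop_action_def
  by (rule tensor_lift_tensor[OF loop.vector_space_axioms loop_action_bilinear_pairs])

lemma loop_action_linear: "Vector_Spaces.linear scale_loop scale_loop (\<lambda>X. loop_action X b)"
  unfolding loop_action_def
  by (rule tensor_lift_linear[OF loop.vector_space_axioms loop_action_bilinear_pairs])

lemma sl2_bracket_bilinear:
  "sl2_bracket (u + v) w = sl2_bracket u w + sl2_bracket v w"
  "sl2_bracket w (u + v) = sl2_bracket w u + sl2_bracket w v"
  "sl2_bracket (scale_sl2 c u) w = scale_sl2 c (sl2_bracket u w)"
  "sl2_bracket w (scale_sl2 c u) = scale_sl2 c (sl2_bracket w u)"
  by (simp_all add: sl2_defs algebra_simps)

lemma loop_bracket_inner_bilinear_pairs:
  "bilinear_pairs scale_loop (\<lambda>v b. sl2_bracket u v \<otimes> (a * b))"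
proof -
  have "a * scale_three_point c b = scale_three_point c (a * b)" for c b
    by (simp add: scale_three_point_def ac_simps)
  then show ?thesis
    by (simp add: bilinear_pairs_def sl2_bracket_bilinear tensor_bilinear distrib_left)
qed

lemma loop_induct [case_names tensor add scale]:
  assumes "\<And>u a. P (u \<otimes> a)" "\<And>X Y. P X \<Longrightarrow> P Y \<Longrightarrow> P (X + Y)"
    "\<And>c X. P X \<Longrightarrow> P (scale_loop c X)"
  shows "P X"
proof -
  have "P (abs_loop_sl2 p)" for p
  proof (induction p rule: Poly_Mapping.update_induct)
    case const
    have "P (scale_loop 0 (0 \<otimes> 0))" by (intro assms)
    then show ?case by (simp add: zero_loop_sl2_def)
  next
    case (update p k v)
    have "Poly_Mapping.update k v p = p + scale_free v (free_gen (fst k) (snd k))"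
      using update.hyps
      by (intro poly_mapping_eqI)
        (auto simp: lookup_update lookup_add lookup_single when_def in_keys_iff)
    then have "abs_loop_sl2 (Poly_Mapping.update k v p)
        = abs_loop_sl2 p + scale_loop v (fst k \<otimes> snd k)"
      by (simp add: scale_loop.abs_eq tensor.abs_eq plus_loop_sl2.abs_eq)
    then show ?case using assms update by simp
  qed
  then show ?thesis by (metis abs_rep_loop)
qed

lemma loop_bracket_outer_bilinear_pairs:
  "bilinear_pairs scale_loop
    (\<lambda>u a. tensor_lift scale_loop (\<lambda>v b. sl2_bracket u v \<otimes> (a * b)) Y)"
proof -
  define T where "T u a Y = tensor_lift scale_loop (\<lambda>v b. sl2_bracket u v \<otimes> (a * b)) Y"
    for u :: "'a sl2" and a Y
  have lin: "Vector_Spaces.linear scale_loop scale_loop (T u a)" for u a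
    unfolding T_def
    by (rule tensor_lift_linear[OF loop.vector_space_axioms loop_bracket_inner_bilinear_pairs])
  have add: "T u a (X + Y) = T u a X + T u a Y" and scale: "T u a (scale_loop c X) = scale_loop c (T u a X)"
    for u a c X Y
    using lin[of u a] by (simp_all add: Vector_Spaces.linear_iff)
  have pure: "T u a (v \<otimes> b) = sl2_bracket u v \<otimes> (a * b)" for u a v b
    unfolding T_def
    by (rule tensor_lift_tensor[OF loop.vector_space_axioms loop_bracket_inner_bilinear_pairs])
  have scA: "scale_three_point c a * b = scale_three_point c (a * b)" for c and a b :: "'a three_point"
    by (simp add: scale_three_point_def ac_simps)
  have "T (u + v) a Y = T u a Y + T v a Y" for u v a
    by (induction Y rule: loop_induct)
      (simp_all add: pure add scale sl2_bracket_bilinear tensor_bilinear loop.scale_right_distrib)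
  moreover have "T u (a + b) Y = T u a Y + T u b Y" for u a b
    by (induction Y rule: loop_induct)
      (simp_all add: pure add scale distrib_right tensor_bilinear loop.scale_right_distrib)
  moreover have "T (scale_sl2 c u) a Y = scale_loop c (T u a Y)" for c u a
    by (induction Y rule: loop_induct)
      (simp_all add: pure add scale sl2_bracket_bilinear tensor_bilinear loop.scale_right_distrib
        loop.scale_left_commute[of c] del: loop.scale_scale)
  moreover have "T u (scale_three_point c a) Y = scale_loop c (T u a Y)" for c u a
    by (induction Y rule: loop_induct)
      (simp_all add: pure add scale scA tensor_bilinear loop.scale_right_distrib
        loop.scale_left_commute[of c] del: loop.scale_scale)
  ultimately show ?thesis by (simp add: bilinear_pairs_def T_def)
qed

lemma loop_bracket_tensor:
  "loop_bracket (u \<otimes> a) (v \<otimes> b) = sl2_bracket u v \<otimes> (a * b)"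
  unfolding loop_bracket_def
    tensor_lift_tensor[OF loop.vector_space_axioms loop_bracket_outer_bilinear_pairs]
  by (rule tensor_lift_tensor[OF loop.vector_space_axioms loop_bracket_inner_bilinear_pairs])

lemma loop_bracket_linear_left:
  "Vector_Spaces.linear scale_loop scale_loop (\<lambda>X. loop_bracket X Y)"
  unfolding loop_bracket_def
  by (rule tensor_lift_linear[OF loop.vector_space_axioms loop_bracket_outer_bilinear_pairs])

lemma loop_bracket_linear_right:
  "Vector_Spaces.linear scale_loop scale_loop (loop_bracket X)"
proof -
  have inner: "tensor_lift scale_loop (\<lambda>v b. sl2_bracket u v \<otimes> (a * b)) (Y + Z) =
      tensor_lift scale_loop (\<lambda>v b. sl2_bracket u v \<otimes> (a * b)) Y +
      tensor_lift scale_loop (\<lambda>v b. sl2_bracket u v \<otimes> (a * b)) Z"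
    "tensor_lift scale_loop (\<lambda>v b. sl2_bracket u v \<otimes> (a * b)) (scale_loop c Y) =
      scale_loop c (tensor_lift scale_loop (\<lambda>v b. sl2_bracket u v \<otimes> (a * b)) Y)"
    for u :: "'a sl2" and a Y Z c
    using tensor_lift_linear[OF loop.vector_space_axioms loop_bracket_inner_bilinear_pairs[of u a]]
    by (simp_all add: Vector_Spaces.linear_iff)
  have left: "loop_bracket (X + X') Y = loop_bracket X Y + loop_bracket X' Y"
    "loop_bracket (scale_loop c X) Y = scale_loop c (loop_bracket X Y)" for X X' Y :: "'a loop_sl2" and c
    using loop_bracket_linear_left[of Y] by (simp_all add: Vector_Spaces.linear_iff)
  have pure: "loop_bracket (u \<otimes> a) Y = tensor_lift scale_loop (\<lambda>v b. sl2_bracket u v \<otimes> (a * b)) Y"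
    for u :: "'a sl2" and a Y
    unfolding loop_bracket_def
    by (simp add: tensor_lift_tensor loop.vector_space_axioms loop_bracket_outer_bilinear_pairs)
  have "loop_bracket X (Y + Z) = loop_bracket X Y + loop_bracket X Z" for Y Z
    by (induction X rule: loop_induct)
      (simp_all add: pure inner left loop.scale_right_distrib)
  moreover have "loop_bracket X (scale_loop c Y) = scale_loop c (loop_bracket X Y)" for c Y
    by (induction X rule: loop_induct)
      (simp_all add: pure inner left loop.scale_right_distrib
        loop.scale_left_commute[of c] del: loop.scale_scale)
  ultimately show ?thesis by (simp add: Vector_Spaces.linear_iff loop.vector_space_axioms)
qed

section \<open>The Onsager Lie algebra\<close>

definition lie_subalgebra :: "'a::field loop_sl2 set \<Rightarrow> bool" where
  "lie_subalgebra H \<longleftrightarrow>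
     loop.subspace H \<and> (\<forall>X\<in>H. \<forall>Y\<in>H. loop_bracket X Y \<in> H)"

definition onsager_A :: "'a::field loop_sl2" where
  "onsager_A = sl2_x \<otimes> 1"

definition onsager_B :: "'a::field loop_sl2" where
  "onsager_B = sl2_y \<otimes> tvar + sl2_z \<otimes> (tvar - 1)"

text \<open>The Onsager Lie algebra, abstractly presented by the generators \<open>A, B\<close> and the Dolan-Grady
  relations, is identified with its image in the loop algebra.\<close>

definition onsager :: "'a::field loop_sl2 set" where
  "onsager = lie_subalgebra hull {onsager_A, onsager_B}"

definition A_upup :: "nat \<Rightarrow> 'a::field loop_sl2" where
  "A_upup i = sl2_x \<otimes> (tvar - 1) ^ i"

definition B_upup :: "nat \<Rightarrow> 'a::field loop_sl2" where
  "B_upup i = loop_action (sl2_y \<otimes> tvar + sl2_z \<otimes> (tvar - 1)) ((tvar - 1) ^ i)"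

text \<open>Only the indices \<open>i \<ge> 1\<close> are used.\<close>

definition psi_upup :: "nat \<Rightarrow> 'a::field loop_sl2" where
  "psi_upup i = sl2_z \<otimes> (tvar - 1) ^ i"

text \<open>The sequence \<open>A\<^sub>0, B\<^sub>0, \<psi>\<^sub>1, A\<^sub>1, B\<^sub>1, \<psi>\<^sub>2, A\<^sub>2, B\<^sub>2, \<psi>\<^sub>3, \<dots>\<close>.\<close>

definition basis_0312 :: "nat \<Rightarrow> 'a::field loop_sl2" where
  "basis_0312 n =
     (if n mod 3 = 0 then A_upup (n div 3)
      else if n mod 3 = 1 then B_upup (n div 3)
      else psi_upup (n div 3 + 1))"

end

theory Submission
  imports Defs
begin

text \<open>The span of the listed elements is closed under the bracket, because
  \<open>[A\<^sub>i, B\<^sub>j] = 2 A\<^sub>i\<^sub>+\<^sub>j + 2 B\<^sub>i\<^sub>+\<^sub>j - 4 \<psi>\<^sub>i\<^sub>+\<^sub>j\<^sub>+\<^sub>1\<close>, \<open>[\<psi>\<^sub>i, A\<^sub>j] = 2 A\<^sub>i\<^sub>+\<^sub>j + 2 \<psi>\<^sub>i\<^sub>+\<^sub>j\<close>,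
  \<open>[B\<^sub>i, \<psi>\<^sub>j] = 2 B\<^sub>i\<^sub>+\<^sub>j + 2 \<psi>\<^sub>i\<^sub>+\<^sub>j\<close>, and the other brackets of listed elements vanish.
  Solving these equations for \<open>\<psi>\<^sub>i\<close>, \<open>A\<^sub>i\<close> and \<open>B\<^sub>i\<close> with one factor in \<open>{A\<^sub>0, B\<^sub>0}\<close> gives the recursion,
  hence also that every listed element lies in the subalgebra generated by \<open>A\<close> and \<open>B\<close>.
  For independence, the \<open>e\<close>-coordinate only sees the \<open>A\<^sub>i\<close>, the \<open>f\<close>-coordinate only sees the
  \<open>B\<^sub>i\<close>, and the \<open>h\<close>-coordinate of \<open>\<psi>\<^sub>i\<close> is \<open>(t - 1)\<^sup>i\<close>; so everything follows from the independence
  of the powers of \<open>t - 1\<close>.\<close>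

section \<open>Bilinearity and antisymmetry of the loop bracket\<close>

lemma loop_bracket_add_left:
  "loop_bracket (X + Y) Z = loop_bracket X Z + loop_bracket Y Z"
  and loop_bracket_scale_left:
  "loop_bracket (scale_loop c X) Z = scale_loop c (loop_bracket X Z)"
  using loop_bracket_linear_left[of Z] by (simp_all add: Vector_Spaces.linear_iff)

lemma loop_bracket_add_right:
  "loop_bracket X (Y + Z) = loop_bracket X Y + loop_bracket X Z"
  and loop_bracket_scale_right:
  "loop_bracket X (scale_loop c Y) = scale_loop c (loop_bracket X Y)"
  using loop_bracket_linear_right[of X] by (simp_all add: Vector_Spaces.linear_iff)

lemma loop_bracket_zero_left: "loop_bracket 0 X = 0"
  using loop_bracket_scale_left[of 0 0 X] by simp

lemma loop_bracket_zero_right: "loop_bracket X 0 = 0"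
  using loop_bracket_scale_right[of X 0 0] by simp

lemma loop_bracket_alternating_tensor:
  "loop_bracket (u \<otimes> a) (v \<otimes> b) = - loop_bracket (v \<otimes> b) (u \<otimes> a)"
proof -
  \<comment> \<open>The sign is written as scaling by -1 so that \<open>tensor_bilinear(3)\<close>
    carries it through the tensor.\<close>
  have "sl2_bracket u v = scale_sl2 (- 1) (sl2_bracket v u)"
    by (simp add: sl2_defs algebra_simps)
  then show ?thesis
    by (simp add: loop_bracket_tensor tensor_bilinear mult.commute)
qed

lemma loop_bracket_antisym: "loop_bracket X Y = - loop_bracket Y X"
proof (induction X rule: loop_induct)
  case (tensor u a)
  show ?case
    by (induction Y rule: loop_induct)
      (simp_all add: loop_bracket_alternating_tensor[of u] loop_bracket_add_left
        loop_bracket_add_right loop_bracket_scale_left loop_bracket_scale_right)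
qed (simp_all add: loop_bracket_add_left loop_bracket_add_right loop_bracket_scale_left
      loop_bracket_scale_right)

section \<open>Brackets of the listed elements\<close>

lemma B_upup_eq:
  "B_upup i = sl2_y \<otimes> (tvar * (tvar - 1) ^ i) + (sl2_z \<otimes> (tvar - 1) ^ Suc i :: 'a::field loop_sl2)"
  using loop_action_linear[of "(tvar - 1) ^ i :: 'a three_point"]
  by (simp add: B_upup_def loop_action_tensor Vector_Spaces.linear_iff)

text \<open>Since t = (t - 1) + 1, a stray factor t can be traded for powers of t - 1, the only ones
  that occur with x and z in the list.\<close>

lemma tensor_tvar_mult:
  "u \<otimes> (tvar * a) = u \<otimes> ((tvar - 1) * a) + u \<otimes> a"
  by (simp add: algebra_simps flip: tensor_bilinear(2))

text \<open>The zero is written as a scaling so that bilinearity alone turns the tensor into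
  0.\<close>

lemma sl2_bracket_self: "sl2_bracket u u = scale_sl2 0 u"
  by (simp add: sl2_defs)

lemma sl2_bracket_equitable_opposite:
  "sl2_bracket sl2_y sl2_x = scale_sl2 (- 2) sl2_x + scale_sl2 (- 2) sl2_y"
  "sl2_bracket sl2_z sl2_y = scale_sl2 (- 2) sl2_y + scale_sl2 (- 2) sl2_z"
  "sl2_bracket sl2_x sl2_z = scale_sl2 (- 2) sl2_z + scale_sl2 (- 2) sl2_x"
  by (simp_all add: sl2_defs)

text \<open>Unfolding the scalars into sums leaves \<open>bracket_A_B\<close> to cancellation in an
  abelian group.\<close>

lemma scale_loop_2_4: "scale_loop 2 X = X + X" "scale_loop 4 X = X + X + X + X"
proof -
  have "scale_loop (1 + 1) X = X + X" "scale_loop (1 + 1 + 1 + 1) X = X + X + X + X"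
    by (simp_all only: loop.scale_left_distrib loop.scale_one)
  then show "scale_loop 2 X = X + X" "scale_loop 4 X = X + X + X + X" by simp_all
qed

lemmas bracket_simps = loop_bracket_add_left loop_bracket_add_right loop_bracket_tensor
  sl2_bracket_self sl2_bracket_equitable sl2_bracket_equitable_opposite tensor_bilinear(1,3)

lemma bracket_A_A: "loop_bracket (A_upup i) (A_upup j) = 0"
  by (simp add: A_upup_def bracket_simps)

lemma bracket_psi_psi: "loop_bracket (psi_upup i) (psi_upup j) = 0"
  by (simp add: psi_upup_def bracket_simps)

text \<open>The y-z and z-y cross terms both carry t(t - 1)^(i+j+1), so they cancel by
  antisymmetry.\<close>

lemma bracket_B_B: "loop_bracket (B_upup i) (B_upup j) = (0 :: 'a::field loop_sl2)"
proof -
  let ?t = "tvar :: 'a three_point"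
  have "?t * (?t - 1) ^ i * (?t - 1) ^ Suc j = ?t * (?t - 1) ^ Suc (i + j)"
    and "(?t - 1) ^ Suc i * (?t * (?t - 1) ^ j) = ?t * (?t - 1) ^ Suc (i + j)"
    by (simp_all add: power_add ac_simps)
  then show ?thesis
    by (simp add: B_upup_eq bracket_simps del: power_Suc)
qed

text \<open>The x-parts of [x,y] and [x,z] combine to 2x with t(t - 1)^(i+j) - (t - 1)^(i+j+1) = (t
  - 1)^(i+j). The z-part has coefficient -2, whereas 2B contains it with +2; hence the -4.\<close>

lemma bracket_A_B:
  "loop_bracket (A_upup i) (B_upup j) =
    scale_loop 2 (A_upup (i + j)) + scale_loop 2 (B_upup (i + j))
    - scale_loop 4 (psi_upup (Suc (i + j)) :: 'a::field loop_sl2)"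
proof -
  let ?t = "tvar :: 'a three_point"
  have "(?t - 1) ^ i * (?t * (?t - 1) ^ j) = ?t * (?t - 1) ^ (i + j)"
    and "(?t - 1) ^ i * (?t - 1) ^ Suc j = (?t - 1) ^ Suc (i + j)"
    by (simp_all add: power_add ac_simps)
  moreover have "sl2_x \<otimes> (?t * (?t - 1) ^ (i + j)) =
      sl2_x \<otimes> (?t - 1) ^ Suc (i + j) + sl2_x \<otimes> (?t - 1) ^ (i + j)"
    by (simp add: tensor_tvar_mult)
  ultimately show ?thesis
    by (simp add: A_upup_def B_upup_eq psi_upup_def bracket_simps scale_loop_2_4
        del: power_Suc)
qed

lemma bracket_psi_A:
  "loop_bracket (psi_upup i) (A_upup j) =
    scale_loop 2 (A_upup (i + j)) + scale_loop 2 (psi_upup (i + j))"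
  by (simp add: A_upup_def psi_upup_def bracket_simps power_add add.commute)

lemma bracket_B_psi:
  "loop_bracket (B_upup i) (psi_upup j) =
    scale_loop 2 (B_upup (i + j)) + scale_loop 2 (psi_upup (i + j))"
  by (simp add: B_upup_eq psi_upup_def bracket_simps power_add mult.assoc tensor_tvar_mult
      loop.scale_right_distrib)

section \<open>Closure of the span under the bracket\<close>

lemma basis_0312_eqs:
  "basis_0312 (3 * i) = A_upup i"
  "basis_0312 (3 * i + 1) = B_upup i"
  "basis_0312 (3 * i + 2) = psi_upup (Suc i)"
proof -
  have "(3 * i + 1) mod 3 = 1" "(3 * i + 1) div 3 = i" "(3 * i + 2) mod 3 = 2" "(3 * i + 2) div 3 = i"
    by presburger+
  then show "basis_0312 (3 * i) = A_upup i" "basis_0312 (3 * i + 1) = B_upup i"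
    "basis_0312 (3 * i + 2) = psi_upup (Suc i)"
    by (simp_all only: basis_0312_def) simp_all
qed

lemma basis_0312_cases:
  fixes n
  defines "b \<equiv> basis_0312 n :: 'a::field loop_sl2"
  obtains i where "b = A_upup i" | i where "b = B_upup i" | i where "b = psi_upup (Suc i)"
  unfolding b_def basis_0312_def by (metis Suc_eq_plus1)

lemma span_basis_0312_memI:
  "A_upup i \<in> loop.span (range basis_0312)"
  "B_upup i \<in> loop.span (range basis_0312)"
  "psi_upup (Suc i) \<in> loop.span (range basis_0312)"
  by (metis basis_0312_eqs loop.span_base rangeI)+

lemma span_bracket_closed:
  assumes "\<And>X Y. X \<in> S \<Longrightarrow> Y \<in> S \<Longrightarrow> loop_bracket X Y \<in> loop.span S"
    and "X \<in> loop.span S" "Y \<in> loop.span S"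
  shows "loop_bracket X Y \<in> loop.span S"
proof -
  have *: "loop_bracket X Z \<in> loop.span S" if Z: "Z \<in> S" for Z
    using assms(2)
    by (induction rule: loop.span_induct_alt)
      (use Z assms(1) in \<open>auto simp: loop_bracket_add_left loop_bracket_scale_left
        loop_bracket_zero_left intro!: loop.span_add loop.span_scale loop.span_zero\<close>)
  show ?thesis
    using assms(3)
    by (induction rule: loop.span_induct_alt)
      (auto simp: * loop_bracket_add_right loop_bracket_scale_right
        loop_bracket_zero_right intro!: loop.span_add loop.span_scale loop.span_zero)
qed

lemma basis_0312_bracket:
  "loop_bracket (basis_0312 m) (basis_0312 n) \<in> loop.span (range (basis_0312 :: nat \<Rightarrow> 'a::field loop_sl2))"
proof -
  let ?V = "loop.span (range (basis_0312 :: nat \<Rightarrow> 'a loop_sl2))"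
  \<comment> \<open>Six of the nine kinds of brackets are computed; antisymmetry supplies the other
    three.\<close>
  have sym: "loop_bracket X Y \<in> ?V" if "loop_bracket Y X \<in> ?V" for X Y
    using loop.span_neg[OF that] loop_bracket_antisym[of X Y] by simp
  note closed = loop.span_add loop.span_diff loop.span_scale span_basis_0312_memI
  have AA: "loop_bracket (A_upup i) (A_upup j) \<in> ?V"
    and BB: "loop_bracket (B_upup i) (B_upup j) \<in> ?V"
    and PP: "loop_bracket (psi_upup (Suc i)) (psi_upup (Suc j)) \<in> ?V" for i j
    by (simp_all add: bracket_A_A bracket_B_B bracket_psi_psi loop.span_zero)
  have AB: "loop_bracket (A_upup i) (B_upup j) \<in> ?V"
    and PA: "loop_bracket (psi_upup (Suc i)) (A_upup j) \<in> ?V"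
    and BP: "loop_bracket (B_upup j) (psi_upup (Suc i)) \<in> ?V" for i j
    unfolding bracket_A_B bracket_psi_A bracket_B_psi add_Suc_right add_Suc by (intro closed)+
  show ?thesis
    by (rule basis_0312_cases[of m, where ?'a = 'a]; rule basis_0312_cases[of n, where ?'a = 'a])
      (simp_all only: AA BB PP AB PA BP AB[THEN sym] PA[THEN sym] BP[THEN sym])
qed

section \<open>The recursion, and the span as the Onsager algebra\<close>

lemma psi_upup_rec:
  fixes i :: nat
  shows "psi_upup (Suc i) = scale_loop (1/2) (A_upup i) + scale_loop (1/2) (B_upup i)
     - scale_loop (1/4) (loop_bracket (A_upup i) (B_upup 0) :: 'a::field_char_0 loop_sl2)"
  \<comment> \<open>This solves \<open>bracket_A_B\<close> at j = 0; characteristic zero makes 2 and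
    4 invertible.\<close>
  by (simp add: bracket_A_B loop.scale_right_distrib loop.scale_right_diff_distrib)

lemma A_upup_rec:
  "A_upup i = scale_loop (1/2) (loop_bracket (psi_upup i) (A_upup 0)) -
    (psi_upup i :: 'a::field_char_0 loop_sl2)"
  by (simp add: bracket_psi_A loop.scale_right_distrib)

lemma B_upup_rec:
  "B_upup i = scale_loop (1/2) (loop_bracket (B_upup 0) (psi_upup i)) -
    (psi_upup i :: 'a::field_char_0 loop_sl2)"
  by (simp add: bracket_B_psi loop.scale_right_distrib)

lemma A_upup_0: "A_upup 0 = onsager_A"
  by (simp add: A_upup_def onsager_A_def)

lemma B_upup_0: "B_upup 0 = onsager_B"
  by (simp add: B_upup_eq onsager_B_def)

lemma lie_subalgebra_onsager: "lie_subalgebra onsager"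
  unfolding onsager_def
  by (rule hull_in) (auto simp: lie_subalgebra_def loop.subspace_Inter)

lemma upup_mem_onsager:
  "A_upup i \<in> (onsager :: 'a::field_char_0 loop_sl2 set) \<and> B_upup i \<in> (onsager :: 'a loop_sl2 set)"
  and psi_upup_mem_onsager: "psi_upup (Suc i) \<in> (onsager :: 'a::field_char_0 loop_sl2 set)"
proof -
  let ?O = "onsager :: 'a loop_sl2 set"
  have gen: "A_upup 0 \<in> ?O" "B_upup 0 \<in> ?O"
    by (simp_all add: A_upup_0 B_upup_0 onsager_def hull_inc)
  have sub: "loop.subspace ?O" and br: "\<And>X Y. X \<in> ?O \<Longrightarrow> Y \<in> ?O \<Longrightarrow> loop_bracket X Y \<in> ?O"
    using lie_subalgebra_onsager by (auto simp: lie_subalgebra_def)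
  note cl = loop.subspace_add[OF sub] loop.subspace_diff[OF sub] loop.subspace_scale[OF sub] br gen
  \<comment> \<open>The recursion runs in stages: level j of A and B gives \<psi> at level j + 1,
    which in turn gives A and B at level j + 1.\<close>
  have psi: "psi_upup (Suc j) \<in> ?O" if "A_upup j \<in> ?O \<and> B_upup j \<in> ?O" for j
    using that by (subst psi_upup_rec) (intro cl; simp)
  show AB: "A_upup i \<in> ?O \<and> B_upup i \<in> ?O"
  proof (induction i)
    case (Suc i)
    from psi[OF Suc] show ?case
      by (subst A_upup_rec, subst B_upup_rec) (intro conjI cl)
  qed (simp add: gen)
  show "psi_upup (Suc i) \<in> ?O"
    by (rule psi[OF AB])
qed

lemma span_basis_0312: "loop.span (range basis_0312) = (onsager :: 'a::field_char_0 loop_sl2 set)"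
proof
  show "loop.span (range basis_0312) \<subseteq> (onsager :: 'a loop_sl2 set)"
  proof (rule loop.span_minimal)
    show "range basis_0312 \<subseteq> (onsager :: 'a loop_sl2 set)"
      using upup_mem_onsager psi_upup_mem_onsager by (auto simp: basis_0312_def)
    show "loop.subspace (onsager :: 'a loop_sl2 set)"
      using lie_subalgebra_onsager[where ?'a = 'a] by (simp add: lie_subalgebra_def)
  qed
  show "(onsager :: 'a loop_sl2 set) \<subseteq> loop.span (range basis_0312)"
    unfolding onsager_def
  proof (rule hull_minimal)
    show "{onsager_A, onsager_B} \<subseteq> loop.span (range basis_0312)"
      by (auto simp: span_basis_0312_memI simp flip: A_upup_0 B_upup_0)
    show "lie_subalgebra (loop.span (range basis_0312))"
      by (auto simp: lie_subalgebra_def loop.subspace_span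
          intro!: span_bracket_closed basis_0312_bracket)
  qed
qed

section \<open>Linear independence through coordinates\<close>

lemma vector_space_scale_three_point: "vector_space (scale_three_point :: 'a::field \<Rightarrow> _)"
  by standard (simp_all add: scale_three_point_def const_three_point_hom algebra_simps)

lemma const_three_point_0 [simp]: "const_three_point 0 = 0"
  using const_three_point_hom(1)[of 0 0] by simp

text \<open>Such a combination is a polynomial composed with t - 1, and composition with a
  nonconstant polynomial is injective. The exponent map \<open>g\<close> allows sums over one
  residue class of indices mod 3.\<close>

lemma three_point_powers_independent:
  fixes c :: "'b \<Rightarrow> 'a::field"
  assumes "finite S" "inj_on g S"
    and zero: "(\<Sum>n\<in>S. scale_three_point (c n) ((tvar - 1) ^ g n)) = 0"
    and "k \<in> S"
  shows "c k = 0"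
proof -
  let ?p = "\<Sum>n\<in>S. monom (c n) (g n)"
  have pow: "rat_of_three_point ((tvar - 1) ^ i) = to_fract ([:- 1, 1:] ^ i :: 'a poly)" for i
  proof (induction i)
    case (Suc i)
    have "Fract [:0, 1:] 1 - 1 = to_fract ([:- 1, 1:] :: 'a poly)"
      by (simp add: to_fract_def One_fract_def one_pCons)
    with Suc show ?case
      by (simp add: times_three_point.rep_eq minus_three_point.rep_eq tvar.rep_eq
          one_three_point.rep_eq del: mult_pCons_left)
  qed (simp add: one_three_point.rep_eq)
  have summand: "rat_of_three_point (scale_three_point (c n) ((tvar - 1) ^ g n))
      = to_fract (pcompose (monom (c n) (g n)) [:- 1, 1:])" for n
    by (simp add: scale_three_point_def times_three_point.rep_eq pow const_three_point.rep_eq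
        pcompose_altdef map_poly_monom poly_monom flip: to_fract_def to_fract_mult)
  have "rat_of_three_point (\<Sum>n\<in>T. f n) = (\<Sum>n\<in>T. rat_of_three_point (f n))"
    for T and f :: "'b \<Rightarrow> 'a three_point"
    by (induction T rule: infinite_finite_induct)
      (simp_all add: plus_three_point.rep_eq zero_three_point.rep_eq)
  from arg_cong[OF zero, of rat_of_three_point, unfolded this summand]
  have "to_fract (pcompose ?p [:- 1, 1:]) = 0"
    by (simp add: zero_three_point.rep_eq pcompose_sum)
  then have "?p = 0"
    by (simp add: pcompose_eq_0_iff)
  then have "0 = coeff ?p (g k)" by simp
  also have "\<dots> = (\<Sum>n\<in>S. if n = k then c n else 0)"
    unfolding coeff_sum coeff_monom
    by (rule sum.cong) (use assms in \<open>auto dest: inj_onD\<close>)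
  also have "\<dots> = c k"
    using assms by simp
  finally show ?thesis by simp
qed

text \<open>For a linear functional \<open>g\<close> this is \<open>g\<close> tensored with the
  identity, with values in the field tensored with the algebra, that is, in the algebra
  itself.\<close>

definition loop_coord :: "('a::field sl2 \<Rightarrow> 'a) \<Rightarrow> 'a loop_sl2 \<Rightarrow> 'a three_point" where
  "loop_coord g = tensor_lift scale_three_point (\<lambda>u a. scale_three_point (g u) a)"

lemma
  assumes "g \<in> {coord_e, coord_f, coord_h}"
  shows loop_coord_linear: "Vector_Spaces.linear scale_loop scale_three_point (loop_coord g)"
    and loop_coord_tensor: "loop_coord g (u \<otimes> a) = scale_three_point (g u) a"
proof -
  have "bilinear_pairs scale_three_point (\<lambda>u a. scale_three_point (g u) a)"
    using assms
    by (auto simp: bilinear_pairs_def scale_three_point_def const_three_point_hom sl2_defs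
        algebra_simps)
  then show "Vector_Spaces.linear scale_loop scale_three_point (loop_coord g)"
    and "loop_coord g (u \<otimes> a) = scale_three_point (g u) a"
    unfolding loop_coord_def
    by (rule tensor_lift_linear[OF vector_space_scale_three_point]
        tensor_lift_tensor[OF vector_space_scale_three_point])+
qed

text \<open>This reads off x = 2e - h and y = -2f - h. The h-coordinate is restricted to the \<psi>
  elements because x and y have h-components too.\<close>

lemma loop_coord_basis_0312:
  fixes n
  defines "b \<equiv> basis_0312 n :: 'a::field loop_sl2"
  shows "loop_coord coord_e b =
      (if n mod 3 = 0 then scale_three_point 2 ((tvar - 1) ^ (n div 3)) else 0)"
    and "loop_coord coord_f b =
      (if n mod 3 = 1 then scale_three_point (- 2) (tvar * (tvar - 1) ^ (n div 3)) else 0)"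
    and "n mod 3 = 2 \<Longrightarrow> loop_coord coord_h b = (tvar - 1) ^ Suc (n div 3)"
proof -
  have add: "loop_coord g (X + Y) = loop_coord g X + loop_coord g Y"
    if "g \<in> {coord_e, coord_f, coord_h}" for g and X Y :: "'a loop_sl2"
    using loop_coord_linear[OF that] by (simp add: Vector_Spaces.linear_iff)
  show "loop_coord coord_e b =
      (if n mod 3 = 0 then scale_three_point 2 ((tvar - 1) ^ (n div 3)) else 0)"
    "loop_coord coord_f b =
      (if n mod 3 = 1 then scale_three_point (- 2) (tvar * (tvar - 1) ^ (n div 3)) else 0)"
    "n mod 3 = 2 \<Longrightarrow> loop_coord coord_h b = (tvar - 1) ^ Suc (n div 3)"
    by (simp_all add: b_def basis_0312_def A_upup_def B_upup_eq psi_upup_def add loop_coord_tensor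
        sl2_defs scale_three_point_def const_three_point_hom)
qed

text \<open>Relations are indexed by positions rather than by elements, so that injectivity and
  independence both follow.\<close>

lemma basis_0312_coeffs_eq_0:
  fixes c :: "nat \<Rightarrow> 'a::field_char_0"
  assumes S: "finite S" and zero: "(\<Sum>n\<in>S. scale_loop (c n) (basis_0312 n)) = 0"
    and k: "k \<in> S"
  shows "c k = 0"
proof -
  let ?S = "\<lambda>r. {n \<in> S. n mod 3 = r}"
  have inj: "inj_on (\<lambda>n. n div 3) (?S r)" for r
    by (rule inj_onI) (metis (mono_tags, lifting) div_mult_mod_eq mem_Collect_eq)
  interpret T: vector_space "scale_three_point :: 'a \<Rightarrow> _"
    by (rule vector_space_scale_three_point)
  have coord: "(\<Sum>n\<in>S. scale_three_point (c n) (loop_coord g (basis_0312 n))) = 0"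
    if g: "g \<in> {coord_e, coord_f, coord_h}" for g
  proof -
    interpret L: Vector_Spaces.linear scale_loop scale_three_point "loop_coord g"
      by (rule loop_coord_linear[OF g])
    show ?thesis
      using arg_cong[OF zero, of "loop_coord g"] by (simp add: L.sum L.scale)
  qed
  have "(\<Sum>n\<in>?S 0. scale_three_point (2 * c n) ((tvar - 1) ^ (n div 3))) = 0"
    using coord[of coord_e] S
    by (simp add: loop_coord_basis_0312 if_distrib sum.inter_filter mult.commute cong: if_cong)
  from three_point_powers_independent[OF _ inj this] S
  have c0: "c n = 0" if "n \<in> S" "n mod 3 = 0" for n
    using that by simp
  \<comment> \<open>Multiplying by the inverse of t strips the factor t from the
    f-coordinates.\<close>
  obtain a :: "'a three_point" where a: "tvar * a = 1"
    using tvar_invertible by blast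
  have tvar_cancel: "a * scale_three_point r (tvar * b) = scale_three_point r b" for r b
    using a by (simp add: scale_three_point_def ac_simps) (metis mult.assoc mult_1)
  have "(\<Sum>n\<in>?S 1. scale_three_point (- 2 * c n) (tvar * (tvar - 1) ^ (n div 3))) = 0"
    using coord[of coord_f] S
    by (simp add: loop_coord_basis_0312 if_distrib sum.inter_filter mult.commute cong: if_cong)
  from arg_cong[OF this, of "(*) a"]
  have "(\<Sum>n\<in>?S 1. scale_three_point (- 2 * c n) ((tvar - 1) ^ (n div 3))) = 0"
    by (simp add: sum_distrib_left tvar_cancel)
  from three_point_powers_independent[OF _ inj this] S
  have c1: "c n = 0" if "n \<in> S" "n mod 3 = 1" for n
    using that by simp
  \<comment> \<open>The A and B terms drop out of the h-coordinate because their coefficients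
    already vanish.\<close>
  have "(\<Sum>n\<in>?S 2. scale_three_point (c n) ((tvar - 1) ^ Suc (n div 3))) =
    (\<Sum>n\<in>S. scale_three_point (c n) (loop_coord coord_h (basis_0312 n)))"
    unfolding sum.inter_filter[OF S]
  proof (rule sum.cong)
    fix n assume "n \<in> S"
    moreover have "n mod 3 = 0 \<or> n mod 3 = 1 \<or> n mod 3 = 2" by arith
    ultimately show "(if n mod 3 = 2 then scale_three_point (c n) ((tvar - 1) ^ Suc (n div 3)) else 0) =
        scale_three_point (c n) (loop_coord coord_h (basis_0312 n))"
      using c0 c1 by (auto simp: loop_coord_basis_0312(3) simp del: power_Suc)
  qed simp
  also have "\<dots> = 0" by (rule coord) simp
  finally have "(\<Sum>n\<in>?S 2. scale_three_point (c n) ((tvar - 1) ^ Suc (n div 3))) = 0" .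
  from three_point_powers_independent[OF _ _ this] S inj[of 2]
  have c2: "c n = 0" if "n \<in> S" "n mod 3 = 2" for n
    using that by (simp add: inj_on_def)
  have "k mod 3 = 0 \<or> k mod 3 = 1 \<or> k mod 3 = 2" by arith
  with c0[OF k] c1[OF k] c2[OF k] show ?thesis by argo
qed

lemma inj_basis_0312: "inj (basis_0312 :: nat \<Rightarrow> 'a::field_char_0 loop_sl2)"
proof (rule injI, rule ccontr)
  fix m n assume eq: "basis_0312 m = (basis_0312 n :: 'a loop_sl2)" and "m \<noteq> n"
  \<comment> \<open>A repetition would be a relation with coefficients 1 and -1.\<close>
  then show False
    using basis_0312_coeffs_eq_0[of "{m, n}" "\<lambda>i. if i = m then 1 else - 1 :: 'a" m] by simp
qed

lemma independent_basis_0312: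
  "loop.independent (range (basis_0312 :: nat \<Rightarrow> 'a::field_char_0 loop_sl2))"
proof (unfold loop.independent_explicit_module, intro allI impI)
  fix T and u :: "'a loop_sl2 \<Rightarrow> 'a" and X
  assume "finite T" and T: "T \<subseteq> range basis_0312" and zero: "(\<Sum>v\<in>T. scale_loop (u v) v) = 0"
    and "X \<in> T"
  obtain S where S: "T = basis_0312 ` S"
    using T by (meson subset_imageE)
  have inj: "inj_on (basis_0312 :: nat \<Rightarrow> 'a loop_sl2) S"
    using inj_basis_0312 by (rule inj_on_subset) simp
  with \<open>finite T\<close> S have "finite S"
    using finite_imageD by blast
  moreover have "(\<Sum>n\<in>S. scale_loop (u (basis_0312 n)) (basis_0312 n)) = 0"
    using zero inj by (simp add: S sum.reindex)
  ultimately show "u X = 0"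
    using basis_0312_coeffs_eq_0[of S "u \<circ> basis_0312"] \<open>X \<in> T\<close> S by auto
qed

text \<open>The clause on all \<open>s\<close> expresses "recursively obtained": the initial values
  and the equations determine the whole sequence.\<close>

theorem corollary6p5:
  fixes A B :: "'a::field_char_0 loop_sl2"
  assumes A: "A = onsager_A" and B: "B = onsager_B"
  shows
    "inj (basis_0312 :: nat \<Rightarrow> 'a loop_sl2)
     \<and> loop.independent (range (basis_0312 :: nat \<Rightarrow> 'a loop_sl2))
     \<and> loop.span (range (basis_0312 :: nat \<Rightarrow> 'a loop_sl2)) = onsager
     \<and> A_upup 0 = A
     \<and> B_upup 0 = B
     \<and> (\<forall>i\<ge>1.
          psi_upup i = scale_loop (1/2) (A_upup (i - 1)) + scale_loop (1/2) (B_upup (i - 1))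
                       - scale_loop (1/4) (loop_bracket (A_upup (i - 1)) B)
        \<and> A_upup i = scale_loop (1/2) (loop_bracket (psi_upup i) A) - psi_upup i
        \<and> B_upup i = scale_loop (1/2) (loop_bracket B (psi_upup i)) - psi_upup i)
     \<and> (\<forall>s :: nat \<Rightarrow> 'a loop_sl2.
          s 0 = A \<and> s 1 = B
          \<and> (\<forall>i\<ge>1.
               s (3 * i - 1) = scale_loop (1/2) (s (3 * i - 3)) + scale_loop (1/2) (s (3 * i - 2))
                               - scale_loop (1/4) (loop_bracket (s (3 * i - 3)) B)
             \<and> s (3 * i) = scale_loop (1/2) (loop_bracket (s (3 * i - 1)) A) - s (3 * i - 1)
             \<and> s (3 * i + 1) = scale_loop (1/2) (loop_bracket B (s (3 * i - 1))) - s (3 * i - 1))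
          \<longrightarrow> s = basis_0312)"
proof (intro conjI allI impI)
  show "inj (basis_0312 :: nat \<Rightarrow> 'a loop_sl2)"
    and "loop.independent (range (basis_0312 :: nat \<Rightarrow> 'a loop_sl2))"
    and "loop.span (range (basis_0312 :: nat \<Rightarrow> 'a loop_sl2)) = onsager"
    by (rule inj_basis_0312 independent_basis_0312 span_basis_0312)+
  show A0: "A_upup 0 = A" and B0: "B_upup 0 = B"
    by (simp_all add: A B A_upup_0 B_upup_0)
  show psi: "psi_upup i = scale_loop (1/2) (A_upup (i - 1)) + scale_loop (1/2) (B_upup (i - 1))
      - scale_loop (1/4) (loop_bracket (A_upup (i - 1)) B)" if "1 \<le> i" for i
    using psi_upup_rec[of "i - 1", where ?'a = 'a] that by (simp add: B0)
  show A_rec: "A_upup i = scale_loop (1/2) (loop_bracket (psi_upup i) A) - psi_upup i"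
    and B_rec: "B_upup i = scale_loop (1/2) (loop_bracket B (psi_upup i)) - psi_upup i" for i
    unfolding A0[symmetric] B0[symmetric] by (rule A_upup_rec B_upup_rec)+
  fix s :: "nat \<Rightarrow> 'a loop_sl2"
  assume s: "s 0 = A \<and> s 1 = B
    \<and> (\<forall>i\<ge>1.
         s (3 * i - 1) = scale_loop (1/2) (s (3 * i - 3)) + scale_loop (1/2) (s (3 * i - 2))
                         - scale_loop (1/4) (loop_bracket (s (3 * i - 3)) B)
       \<and> s (3 * i) = scale_loop (1/2) (loop_bracket (s (3 * i - 1)) A) - s (3 * i - 1)
       \<and> s (3 * i + 1) = scale_loop (1/2) (loop_bracket B (s (3 * i - 1))) - s (3 * i - 1))"
  \<comment> \<open>With i = j + 1 the positions 3i - 3, 3i - 2, 3i - 1 become 3j, 3j + 1, 3j +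
    2.\<close>
  have s_psi: "s (3 * j + 2) = psi_upup (Suc j)"
    if "s (3 * j) = A_upup j" "s (3 * j + 1) = B_upup j" for j
    using conjunct2[OF conjunct2[OF s], rule_format, of "Suc j"] that psi[of "Suc j"]
    by simp
  have s_AB: "s (3 * j) = A_upup j \<and> s (3 * j + 1) = B_upup j" for j
  proof (induction j)
    case 0
    show ?case using s by (simp add: A0 B0)
  next
    case (Suc j)
    have "s (3 * Suc j - 1) = psi_upup (Suc j)"
      using s_psi[of j] Suc by simp
    with conjunct2[OF conjunct2[OF s], rule_format, of "Suc j"] show ?case
      unfolding A_rec[of "Suc j"] B_rec[of "Suc j"] by simp
  qed
  show "s = basis_0312"
  proof
    fix n :: nat
    define j where "j = n div 3"
    consider "n = 3 * j" | "n = 3 * j + 1" | "n = 3 * j + 2"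
      unfolding j_def by linarith
    then show "s n = basis_0312 n"
      by cases (simp_all only: basis_0312_eqs s_AB s_psi)
  qed
qed

end
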